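(* Let $\nu,m,n$ be nonnegative integers with $m+n>0$. Then, as polynomials in $x$, $$\sum_{j=0}^{m}\binom{m}{j}\binom{n+j}{\nu}B_{n+j-\nu}(x)=\sum_{k=0}^{n}(-1)^{n-k}\binom{n}{k}\binom{m+k}{\nu}B_{m+k-\nu}(x+1).$$
   Context: The Bernoulli polynomials $B_n(x)$ are defined by $\frac{te^{xt}}{e^t-1}=\sum_{n\ge0}B_n(x)\frac{t^n}{n!}$. Summands in which the binomial coefficient vanishes (i.e. $\nu>n+j$ or $\nu>m+k$, so that the index of $B$ would be negative) are interpreted as $0$. *)

theory Defs
  imports "HOL-Computational_Algebra.Computational_Algebra"
begin

text \<open>
  The generating function t e^(xt) / (e^t - 1) as a power series in t over the polynomial
  ring K[x]. Since K[x] is not a field, the quotient t / (e^t - 1) is formed in K[[t]]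
  (where it is the usual power series with constant term 1), its coefficients are embedded as
  constant polynomials, and the result is multiplied by the series of e^(xt), whose n-th
  coefficient is the monomial x^n / n!.
\<close>

definition bernoulli_gf :: "'a::field_char_0 poly fps" where
  "bernoulli_gf =
     Abs_fps (\<lambda>n. [:fps_nth (fps_X / (fps_exp 1 - 1)) n:]) * Abs_fps (\<lambda>n. monom (1 / fact n) n)"

definition bernpoly :: "nat \<Rightarrow> 'a::field_char_0 poly" where
  "bernpoly n = smult (fact n) (fps_nth bernoulli_gf n)"

text \<open>
  Evaluating the coefficients at any point x gives the defining identity over the field itself.
\<close>

lemma bernpoly_generating_function:
  fixes x :: "'a::field_char_0"
  shows "Abs_fps (\<lambda>n. poly (bernpoly n) x / fact n) = fps_X * fps_exp x / (fps_exp 1 - 1)"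
proof -
  define Q :: "'a fps" where "Q = fps_X / (fps_exp 1 - 1)"
  have nz: "fps_exp 1 - 1 \<noteq> (0::'a fps)"
  proof
    assume "fps_exp 1 - 1 = (0::'a fps)"
    hence "fps_nth (fps_exp 1 - 1 :: 'a fps) 1 = 0" by simp
    thus False by simp
  qed
  have sub: "subdegree (fps_exp 1 - 1 :: 'a fps) = 1"
    by (rule subdegreeI) auto
  have dv: "(fps_exp 1 - 1 :: 'a fps) dvd fps_X"
    using nz sub by (subst fps_dvd_iff) auto
  have "Abs_fps (\<lambda>n. poly (bernpoly n) x / fact n) = Q * fps_exp x"
    by (rule fps_ext)
       (simp add: bernpoly_def bernoulli_gf_def fps_mult_nth poly_sum poly_monom Q_def)
  also have "\<dots> = fps_X * fps_exp x / (fps_exp 1 - 1)"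
    using dv by (simp add: Q_def div_mult_swap mult.commute)
  finally show ?thesis .
qed

end

theory Submission
  imports Defs
begin

text \<open>
  Umbrally, with \<open>y ^ i\<close> standing for \<open>B\<^sub>i(x)\<close>, the translation formula says that \<open>(y + 1) ^ i\<close>
  stands for \<open>B\<^sub>i(x + 1)\<close>. For \<open>\<nu> = 0\<close> the two sides of the theorem are then the expansions of
  \<open>y ^ n * (y + 1) ^ m\<close> in powers of \<open>y\<close> and of \<open>y + 1\<close>. Since the Bernoulli polynomials form an
  Appell sequence, the general case follows by differentiating \<open>\<nu>\<close> times and dividing by \<open>\<nu>!\<close>.
\<close>

text \<open>Pascal's rule, with the part carrying \<open>n choose (k - 1)\<close> reindexed by
  one.\<close>

lemma binomial_sum_Suc:
  fixes f :: "nat \<Rightarrow> 'a::comm_semiring_1"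
  shows "(\<Sum>k=0..Suc n. of_nat (Suc n choose k) * f k) =
         (\<Sum>k=0..n. of_nat (n choose k) * (f k + f (Suc k)))"
proof -
  have "(\<Sum>k=0..Suc n. of_nat (Suc n choose k) * f k) =
        f 0 + (\<Sum>k=0..n. of_nat (Suc n choose Suc k) * f (Suc k))"
    by (subst sum.atLeast0_atMost_Suc_shift) simp
  also have "\<dots> = (f 0 + (\<Sum>k=0..n. of_nat (n choose Suc k) * f (Suc k))) +
                  (\<Sum>k=0..n. of_nat (n choose k) * f (Suc k))"
    by (simp add: sum.distrib algebra_simps)
  also have "f 0 + (\<Sum>k=0..n. of_nat (n choose Suc k) * f (Suc k)) =
             (\<Sum>k=0..Suc n. of_nat (n choose k) * f k)"
    by (subst sum.atLeast0_atMost_Suc_shift) simp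
  also have "\<dots> = (\<Sum>k=0..n. of_nat (n choose k) * f k)"
    by (simp add: binomial_eq_0)
  finally show ?thesis
    by (simp add: sum.distrib algebra_simps)
qed

text \<open>Both sides, as functions of \<open>m\<close> and \<open>n\<close>, satisfy F(m, n+1) =
  F(m+1, n) - F(m, n), the umbral form of y = (y + 1) - 1. They agree at n = 0 by the hypothesis.
  Since the recurrence raises \<open>m\<close>, the induction on \<open>n\<close> keeps
  \<open>m\<close> arbitrary.\<close>

lemma binomial_transform_shift:
  fixes a b :: "nat \<Rightarrow> 'a::comm_ring_1"
  assumes transform: "\<And>m. b m = (\<Sum>j=0..m. of_nat (m choose j) * a j)"
  shows "(\<Sum>j=0..m. of_nat (m choose j) * a (n + j)) =
         (\<Sum>k=0..n. of_nat (n choose k) * ((-1) ^ (n - k) * b (m + k)))"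
proof (induction n arbitrary: m)
  case 0
  show ?case by (simp add: transform)
next
  case (Suc n)
  let ?F = "\<lambda>m n. \<Sum>j=0..m. of_nat (m choose j) * a (n + j)"
  let ?G = "\<lambda>m n. \<Sum>k=0..n. of_nat (n choose k) * ((-1) ^ (n - k) * b (m + k))"
  have "?F (Suc m) n = ?F m n + ?F m (Suc n)"
    by (subst binomial_sum_Suc) (simp add: sum.distrib ring_distribs)
  moreover have "?G m (Suc n) =
      (\<Sum>k=0..n. of_nat (n choose k) * ((-1) ^ (n - k) * b (Suc m + k)) -
                 of_nat (n choose k) * ((-1) ^ (n - k) * b (m + k)))"
    by (subst binomial_sum_Suc, intro sum.cong refl) (simp add: Suc_diff_le algebra_simps)
  hence "?G m (Suc n) = ?G (Suc m) n - ?G m n"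
    by (simp only: sum_subtractf)
  ultimately show ?case
    by (simp only: Suc.IH[symmetric] add_diff_cancel_left')
qed

text \<open>Differentiating e^(xt) in x multiplies the series by t, which shifts its coefficients by
  one.\<close>

lemma pderiv_bernoulli_gf_Suc:
  "pderiv (fps_nth bernoulli_gf (Suc n)) = fps_nth bernoulli_gf n"
proof -
  have sum_rule: "pderiv (\<Sum>i\<in>A. f i) = (\<Sum>i\<in>A. pderiv (f i))" for f :: "nat \<Rightarrow> 'a poly" and A
    using higher_pderiv_sum[of 1 f A] by simp
  have "pderiv ([:c:] * monom (1 / fact (Suc k)) (Suc k)) = [:c:] * monom (1 / fact k) k"
    for c :: 'a and k
  proof -
    have "of_nat (Suc k) * (1 / fact (Suc k)) = (1 / fact k :: 'a)"
      by (simp add: field_simps del: of_nat_Suc)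
    thus ?thesis
      by (simp add: pderiv_smult pderiv_monom del: of_nat_Suc fact_Suc)
  qed
  \<comment> \<open>The last term of the convolution is constant in x and is split off, as its
    derivative vanishes.\<close>
  moreover have "fps_nth bernoulli_gf (Suc n) =
      (\<Sum>i=0..n. [:fps_nth (fps_X / (fps_exp 1 - 1)) i:] * monom (1 / fact (Suc (n - i))) (Suc (n - i))) +
      [:fps_nth (fps_X / (fps_exp 1 - 1)) (Suc n) :: 'a:]"
    by (simp add: bernoulli_gf_def fps_mult_nth Suc_diff_le del: fact_Suc mult_pCons_left)
  ultimately show ?thesis
    by (simp add: pderiv_add pderiv_pCons sum_rule bernoulli_gf_def fps_mult_nth
        del: fact_Suc mult_pCons_left)
qed

lemma pderiv_bernpoly: "pderiv (bernpoly n) = smult (of_nat n) (bernpoly (n - 1))"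
proof (cases n)
  case 0
  thus ?thesis
    by (simp add: bernpoly_def bernoulli_gf_def pderiv_smult pderiv_monom)
next
  case (Suc k)
  thus ?thesis
    by (simp add: bernpoly_def pderiv_smult pderiv_bernoulli_gf_Suc)
qed

text \<open>The factor is the falling factorial n(n-1)...(n-\<nu>+1). For \<nu> > n the truncated
  index is 0, but the binomial coefficient vanishes, in line with the convention for negative
  indices.\<close>

lemma higher_pderiv_bernpoly:
  "(pderiv ^^ \<nu>) (bernpoly n) = smult (fact \<nu> * of_nat (n choose \<nu>)) (bernpoly (n - \<nu>))"
proof (induction \<nu>)
  case 0
  show ?case by simp
next
  case (Suc \<nu>)
  have "(n choose \<nu>) * (n - \<nu>) = Suc \<nu> * (n choose Suc \<nu>)"
    using binomial_absorb_comp[of n \<nu>] binomial_absorption[of \<nu> n] by (simp only: mult.commute)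
  hence "of_nat (n choose \<nu>) * of_nat (n - \<nu>) = (of_nat (Suc \<nu>) * of_nat (n choose Suc \<nu>) :: 'a)"
    by (metis of_nat_mult)
  thus ?case
    by (simp add: Suc.IH pderiv_smult pderiv_bernpoly mult.assoc mult.left_commute
        del: of_nat_Suc binomial_Suc_Suc)
qed

lemma higher_pderiv_pcompose_shift:
  fixes p :: "'a::idom poly"
  shows "(pderiv ^^ \<nu>) (pcompose p [:c, 1:]) = pcompose ((pderiv ^^ \<nu>) p) [:c, 1:]"
  by (induction \<nu>) (simp_all add: pderiv_pcompose pderiv_pCons)

text \<open>Compare coefficients of t^n after writing e^((x+1)t) = e^(xt) e^t in the generating
  function.\<close>

lemma bernpoly_shift:
  "pcompose (bernpoly n) [:1, 1:] =
   (\<Sum>i=0..n. of_nat (n choose i) * (bernpoly i :: 'a::field_char_0 poly))"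
proof (rule poly_ext)
  fix x :: 'a
  let ?B = "\<lambda>x. Abs_fps (\<lambda>n. poly (bernpoly n) x / fact n)"
  have factor: "?B x = fps_X / (fps_exp 1 - 1) * fps_exp x" for x :: 'a
    by (rule fps_ext)
       (simp add: bernpoly_def bernoulli_gf_def fps_mult_nth poly_sum poly_monom)
  have "?B (x + 1) = ?B x * fps_exp 1"
    by (simp only: factor fps_exp_add_mult mult.assoc)
  from arg_cong[OF this, of "\<lambda>f. fps_nth f n"]
  have "poly (bernpoly n) (x + 1) =
        fact n * (\<Sum>i=0..n. poly (bernpoly i) x / fact i * (1 / fact (n - i)))"
    by (simp add: fps_mult_nth divide_eq_eq)
  also have "\<dots> = (\<Sum>i=0..n. of_nat (n choose i) * poly (bernpoly i) x)"
    unfolding sum_distrib_left by (intro sum.cong refl) (simp add: binomial_fact field_simps)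
  finally show "poly (pcompose (bernpoly n) [:1, 1:]) x =
      poly (\<Sum>i=0..n. of_nat (n choose i) * bernpoly i) x"
    by (simp add: poly_pcompose poly_sum add.commute)
qed

theorem theorem1p7:
  fixes \<nu> m n :: nat
  assumes "m + n > 0"
  shows "(\<Sum>j=0..m. smult (of_nat ((m choose j) * ((n + j) choose \<nu>))) (bernpoly (n + j - \<nu>))) =
         (\<Sum>k=0..n. smult ((-1) ^ (n - k) * of_nat ((n choose k) * ((m + k) choose \<nu>)))
                       (pcompose (bernpoly (m + k - \<nu>)) [:1, 1:] :: 'a::field_char_0 poly))"
  (is "?L = ?R")
proof -
  have sign: "(-1) ^ k * p = smult ((-1) ^ k) p" for k and p :: "'a poly"
    by (induction k) simp_all
  have smult_sum_right: "smult c (\<Sum>i\<in>A. f i) = (\<Sum>i\<in>A. smult c (f i))"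
    for c and f :: "nat \<Rightarrow> 'a poly" and A
    using sum_distrib_left[of "[:c:]" f A] by simp
  \<comment> \<open>This is the case \<nu> = 0.\<close>
  have "(\<Sum>j=0..m. smult (of_nat (m choose j)) (bernpoly (n + j))) =
        (\<Sum>k=0..n. smult ((-1) ^ (n - k) * of_nat (n choose k))
                      (pcompose (bernpoly (m + k)) [:1, 1:] :: 'a poly))"
    using binomial_transform_shift[of "\<lambda>n. pcompose (bernpoly n) [:1, 1:]" "bernpoly :: nat \<Rightarrow> 'a poly" m n,
        OF bernpoly_shift]
    by (simp add: sign of_nat_poly mult.commute)
  \<comment> \<open>Each differentiated Bernoulli polynomial carries the same factor \<nu>!, which
    is nonzero in characteristic 0 and cancels.\<close>
  from arg_cong[OF this, of "pderiv ^^ \<nu>"] have "smult (fact \<nu>) ?L = smult (fact \<nu>) ?R"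
    by (simp add: higher_pderiv_sum higher_pderiv_smult higher_pderiv_pcompose_shift
        higher_pderiv_bernpoly smult_sum_right pcompose_smult mult_ac)
  thus ?thesis
    by (rule smult_cancel[OF fact_nonzero])
qed

end
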